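(* Let $p,n\in\mathbb N$ with $p\ge n-1\ge 4$, and write $p=k(n-1)+r$ with $k\in\mathbb N$ and $r\in\{0,1,\ldots,n-2\}$. Then $$ex(p;T_n^1)=\max\Big\{\Big[\tfrac{(n-2)p}{2}\Big]-(n-1+r),\ \tfrac{(n-2)p-r(n-1-r)}{2}\Big\},$$ and explicitly $$ex(p;T_n^1)=\begin{cases}\big[\tfrac{(n-2)p}{2}\big]-(n-1+r) & \text{if } n\ge 16 \text{ and } 3\le r\le n-6, \text{ or if } 13\le n\le 15 \text{ and } 4\le r\le n-7,\\[2pt] \tfrac{(n-2)p-r(n-1-r)}{2} & \text{otherwise.}\end{cases}$$
   Context: All graphs are finite and simple; a graph "contains" $H$ if it has a subgraph isomorphic to $H$. $\mathbb N=\{1,2,3,\ldots\}$ and $[x]$ denotes the greatest integer not exceeding $x$. For a graph $L$ and $p\in\mathbb N$, $ex(p;L)$ is the maximum number of edges in a graph on $p$ vertices that contains no copy of $L$. For $n\ge 5$, $T_n^1$ is the tree with vertex set $\{v_0,v_1,\ldots,v_{n-1}\}$ and edge set $\{v_0v_1,v_0v_2,\ldots,v_0v_{n-3},\,v_{n-4}v_{n-2},\,v_{n-3}v_{n-1}\}$. *)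

theory Defs
  imports Complex_Main
begin

definition simple_graph :: "'a set \<Rightarrow> 'a set set \<Rightarrow> bool" where
  "simple_graph V E \<longleftrightarrow> finite V \<and>
     (\<forall>e\<in>E. \<exists>u v. e = {u, v} \<and> u \<noteq> v \<and> u \<in> V \<and> v \<in> V)"

definition contains_graph :: "'a set \<Rightarrow> 'a set set \<Rightarrow> 'b set \<Rightarrow> 'b set set \<Rightarrow> bool" where
  "contains_graph V E VH EH \<longleftrightarrow>
     (\<exists>f. inj_on f VH \<and> f ` VH \<subseteq> V \<and> (\<forall>e\<in>EH. f ` e \<in> E))"

definition ex :: "nat \<Rightarrow> 'b set \<Rightarrow> 'b set set \<Rightarrow> nat" where
  "ex p VL EL = Max {card E | E. simple_graph {0..<p} E \<and> \<not> contains_graph {0..<p} E VL EL}"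

definition T1_vertices :: "nat \<Rightarrow> nat set" where
  "T1_vertices n = {0..<n}"

definition T1_edges :: "nat \<Rightarrow> nat set set" where
  "T1_edges n = {{0, i} | i. 1 \<le> i \<and> i \<le> n - 3} \<union> {{n - 4, n - 2}, {n - 3, n - 1}}"

end

theory Submission
  imports Defs
begin

text \<open>
  Put \<open>q = n - 1\<close>. The upper bound is an induction on the number of vertices that removes a vertex
  set \<open>X\<close> meeting few edges. In terms of the number \<open>(n - 2) p - 2 |E|\<close>, which is additive under such
  removals, the claimed value says that it is at least \<open>deficit q p\<close>, and this bound is subadditive
  in \<open>p\<close>; so it suffices to find \<open>X\<close> with \<open>2 t + deficit q |X| \<le> (n - 2) |X|\<close>, where \<open>t\<close> is the number
  of edges meeting \<open>X\<close>. A vertex \<open>v\<close> of maximal degree provides it. If its degree is at most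
  \<open>n - 4\<close>, all vertices may be removed. Otherwise, excluding the tree forces the edges that leave the
  closed neighbourhood of \<open>v\<close> (or, for degree at least \<open>n - 2\<close>, all edges off \<open>v\<close> that meet a neighbour
  of \<open>v\<close>) to be pairwise intersecting, hence to form a star or a triangle, and \<open>X\<close> is the closed
  neighbourhood together with the centre of the star. For \<open>n = 5\<close> the tree is a path, and a
  finer count is needed.

  For the lower bound, one takes copies of the complete graph on \<open>n - 1\<close> vertices together with
  either a complete graph on \<open>r\<close> vertices or a graph on \<open>n - 1 + r\<close> vertices that is as close to
  \<open>(n - 4)\<close>-regular as parity permits.
\<close>

section \<open>Neighbourhoods and touching edges\<close>

definition nbhd :: "'a set set \<Rightarrow> 'a \<Rightarrow> 'a set" where
  "nbhd E v = {u. {v, u} \<in> E}"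

definition touching :: "'a set set \<Rightarrow> 'a set \<Rightarrow> 'a set set" where
  "touching E X = {e \<in> E. e \<inter> X \<noteq> {}}"

definition clique :: "'a set \<Rightarrow> 'a set set" where
  "clique A = {e. e \<subseteq> A \<and> card e = 2}"

lemma nbhd_iff: "u \<in> nbhd E v \<longleftrightarrow> {v, u} \<in> E"
  by (simp add: nbhd_def)

lemma simple_graphD:
  assumes "simple_graph V E" "{u, v} \<in> E"
  shows "u \<noteq> v" "u \<in> V" "v \<in> V"
  using assms unfolding simple_graph_def by (metis doubleton_eq_iff)+

lemma simple_graph_edgeE:
  assumes "simple_graph V E" "e \<in> E" "x \<in> e"
  obtains y where "e = {x, y}" "x \<noteq> y"
  using assms unfolding simple_graph_def by (metis insert_iff insert_commute singletonD)

lemma simple_graph_edges_subset: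
  assumes "simple_graph V E"
  shows "E \<subseteq> clique V"
  using assms unfolding clique_def simple_graph_def by (fastforce simp: card_2_iff)

lemma simple_graph_finite:
  assumes "simple_graph V E"
  shows "finite V" "finite E"
proof -
  show "finite V" using assms by (simp add: simple_graph_def)
  then show "finite E"
    using simple_graph_edges_subset[OF assms]
    by (auto simp: clique_def intro: finite_subset[of E "Pow V"])
qed

lemma simple_graph_nbhd:
  assumes "simple_graph V E"
  shows "nbhd E v \<subseteq> V" "finite (nbhd E v)" "v \<notin> nbhd E v"
proof -
  show 1: "nbhd E v \<subseteq> V" and "v \<notin> nbhd E v"
    using simple_graphD[OF assms, of v] by (auto simp only: nbhd_iff)
  show "finite (nbhd E v)"
    using 1 simple_graph_finite(1)[OF assms] by (rule finite_subset)
qed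

lemma card_clique:
  assumes "finite A"
  shows "finite (clique A)" "2 * card (clique A) = card A * (card A - 1)"
proof -
  show "finite (clique A)"
    using assms by (auto simp: clique_def intro: finite_subset[of _ "Pow A"])
  have "even (card A * (card A - 1))" by (cases "card A") auto
  then show "2 * card (clique A) = card A * (card A - 1)"
    by (simp add: clique_def n_subsets[OF assms] choose_two)
qed

lemma card_edges_at:
  assumes "simple_graph V E"
  shows "card (touching E {v}) = card (nbhd E v)"
proof -
  have "bij_betw (\<lambda>u. {v, u}) (nbhd E v) (touching E {v})"
  proof (rule bij_betwI')
    show "\<exists>x\<in>nbhd E v. y = {v, x}" if "y \<in> touching E {v}" for y
      using that simple_graph_edgeE[OF assms, of y v] by (auto simp: touching_def nbhd_def)
  qed (auto simp: touching_def nbhd_def doubleton_eq_iff)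
  then show ?thesis by (simp add: bij_betw_same_card)
qed

lemma finite_touching: "finite E \<Longrightarrow> finite (touching E X)"
  by (simp add: touching_def)

lemma card_le_add_touching:
  assumes sg: "simple_graph V E" and fin: "finite B" and sub: "A \<subseteq> B \<union> touching E {c}"
  shows "card A \<le> card B + card (nbhd E c)"
proof -
  have "card A \<le> card (B \<union> touching E {c})"
    using sub fin simple_graph_finite[OF sg] by (intro card_mono) (auto simp: finite_touching)
  also have "\<dots> \<le> card B + card (touching E {c})" by (rule card_Un_le)
  finally show ?thesis by (simp add: card_edges_at[OF sg])
qed

text \<open>Without a common point there are pairs \<open>{a, b}\<close> and \<open>{b, c}\<close>
  and a third one avoiding \<open>b\<close>, which can only be \<open>{a, c}\<close>; a pair that
  meets all three sides of a triangle is one of the sides.\<close>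

lemma intersecting_pairs:
  assumes pairs: "\<And>e. e \<in> F \<Longrightarrow> card e = 2"
    and inter: "\<And>e f. e \<in> F \<Longrightarrow> f \<in> F \<Longrightarrow> e \<inter> f \<noteq> {}"
  shows "(\<exists>c. \<forall>e\<in>F. c \<in> e) \<or> finite F \<and> card F \<le> 3"
proof (rule disjCI)
  assume nf: "\<not> (finite F \<and> card F \<le> 3)"
  show "\<exists>c. \<forall>e\<in>F. c \<in> e"
  proof (rule ccontr)
    assume no: "\<not> (\<exists>c. \<forall>e\<in>F. c \<in> e)"
    obtain e where e: "e \<in> F" using nf by fastforce
    then obtain a b where ab: "e = {a, b}" "a \<noteq> b" using pairs by (meson card_2_iff)
    obtain f where f: "f \<in> F" "a \<notin> f" using no by blast
    have "b \<in> f" using inter[OF e f(1)] ab f by auto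
    then obtain c where c: "f = {b, c}" "b \<noteq> c"
      using pairs[OF f(1)] by (metis card_2_iff insert_commute insert_iff singletonD)
    obtain g where g: "g \<in> F" "b \<notin> g" using no by blast
    have "a \<in> g" "c \<in> g" using inter[OF e g(1)] inter[OF f(1) g(1)] ab c g by auto
    have "F \<subseteq> {{a, b}, {b, c}, {a, c}}"
    proof
      fix h assume h: "h \<in> F"
      obtain x y where xy: "h = {x, y}" "x \<noteq> y" using pairs[OF h] by (meson card_2_iff)
      obtain u w where "g = {u, w}" using pairs[OF g(1)] by (meson card_2_iff)
      then have gac: "g = {a, c}" using \<open>a \<in> g\<close> \<open>c \<in> g\<close> f c by auto
      show "h \<in> {{a, b}, {b, c}, {a, c}}"
        using inter[OF e h] inter[OF f(1) h] inter[OF g(1) h] ab c gac xy f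
        by (auto simp: doubleton_eq_iff)
    qed
    moreover have "card {{a, b}, {b, c}, {a, c}} \<le> 3" by (simp add: card_insert_if)
    ultimately have "finite F \<and> card F \<le> 3"
      by (meson card_mono finite.intros finite_subset le_trans)
    then show False using nf by blast
  qed
qed

section \<open>Copies of the tree\<close>

lemma contains_graphE:
  assumes "contains_graph V E VH EH"
  obtains f where "inj_on f VH" "f ` VH \<subseteq> V" "\<And>e. e \<in> EH \<Longrightarrow> f ` e \<in> E"
proof -
  from assms obtain f where "inj_on f VH \<and> f ` VH \<subseteq> V \<and> (\<forall>e\<in>EH. f ` e \<in> E)"
    unfolding contains_graph_def ..
  then show thesis by (intro that[of f]) simp_all
qed

lemma contains_graph_mono:
  assumes "contains_graph V' E' VH EH" "V' \<subseteq> V" "E' \<subseteq> E"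
  shows "contains_graph V E VH EH"
proof -
  obtain f where "inj_on f VH" "f ` VH \<subseteq> V'" "\<forall>e\<in>EH. f ` e \<in> E'"
    using assms(1) by (auto simp: contains_graph_def)
  then show ?thesis
    using assms(2,3) unfolding contains_graph_def by (intro exI[of _ f]) auto
qed

abbreviation T1_free :: "nat \<Rightarrow> 'a set \<Rightarrow> 'a set set \<Rightarrow> bool" where
  "T1_free n V E \<equiv> \<not> contains_graph V E (T1_vertices n) (T1_edges n)"

text \<open>The tree is a spider: a centre \<open>v\<close>, two legs
  \<open>v\<close>-\<open>x1\<close>-\<open>y1\<close> and
  \<open>v\<close>-\<open>x2\<close>-\<open>y2\<close>, and \<open>n - 5\<close> further leaves,
  which are drawn from \<open>S\<close>.\<close>

lemma T1_embedding:
  assumes sg: "simple_graph V E" and n: "n \<ge> 5"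
    and S: "finite S" "S \<subseteq> nbhd E v - {x1, x2, y1, y2}" "n - 5 \<le> card S"
    and edges: "{v, x1} \<in> E" "{v, x2} \<in> E" "{x1, y1} \<in> E" "{x2, y2} \<in> E"
    and dist: "distinct [v, x1, x2, y1, y2]"
  shows "contains_graph V E (T1_vertices n) (T1_edges n)"
proof -
  obtain m where m: "n = m + 5" using n by (metis add.commute le_Suc_ex)
  obtain S' where S': "S' \<subseteq> S" "card S' = m" "finite S'"
    using S m by (metis diff_add_inverse2 obtain_subset_with_card_n)
  obtain g where g: "bij_betw g {1..m} S'"
    using ex_bij_betw_nat_finite_1[OF S'(3)] S'(2) by auto
  have gS: "g i \<in> nbhd E v" "g i \<noteq> x1" "g i \<noteq> x2" "g i \<noteq> y1" "g i \<noteq> y2" "g i \<noteq> v"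
    if "1 \<le> i" "i \<le> m" for i
  proof -
    have "g i \<in> S'" using g that by (auto simp: bij_betw_def)
    then show "g i \<in> nbhd E v" "g i \<noteq> x1" "g i \<noteq> x2" "g i \<noteq> y1" "g i \<noteq> y2" "g i \<noteq> v"
      using S' S simple_graph_nbhd(3)[OF sg, of v] by auto
  qed
  have ginj: "i = j" if "g i = g j" "1 \<le> i" "i \<le> m" "1 \<le> j" "j \<le> m" for i j
    using inj_onD[OF bij_betw_imp_inj_on[OF g] that(1)] that by simp
  \<comment> \<open>Labels follow \<open>T1_edges\<close> with \<open>n = m + 5\<close>: 0 is the
    centre, 1 to \<open>m\<close> are the plain leaves, \<open>m + 1\<close> and
    \<open>m + 2\<close> the inner vertices of the legs, \<open>m + 3\<close> and
    \<open>m + 4\<close> their ends.\<close>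
  define f where "f i = (if i = 0 then v else if i \<le> m then g i else if i = m + 1 then x1
    else if i = m + 2 then x2 else if i = m + 3 then y1 else y2)" for i
  have fv: "f 0 = v" "f (m + 1) = x1" "f (m + 2) = x2" "f (m + 3) = y1" "f (m + 4) = y2"
    by (auto simp: f_def)
  have fg: "f i = g i" if "1 \<le> i" "i \<le> m" for i using that by (simp add: f_def)
  have cases: "i = 0 \<or> (1 \<le> i \<and> i \<le> m) \<or> i = m + 1 \<or> i = m + 2 \<or> i = m + 3 \<or> i = m + 4"
    if "i < n" for i using that unfolding m by presburger
  have "f i \<noteq> f j" if "i < j" "j < n" for i j
  proof -
    have i: "i < n" using that by simp
    have tail: "f j \<in> {x1, x2, y1, y2}" if "\<not> j \<le> m"
      using cases[OF \<open>j < n\<close>] that \<open>i < j\<close> fv by auto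
    show ?thesis
    proof (cases "i \<le> m")
      case True
      show ?thesis
      proof (cases "j \<le> m")
        case True
        then show ?thesis
          using that \<open>i \<le> m\<close> fv(1) fg[of i] fg[of j] gS(6)[of j] ginj[of i j] by (cases "i = 0") auto
      next
        case False
        then show ?thesis
          using tail \<open>i \<le> m\<close> fv(1) fg[of i] gS[of i] dist by (cases "i = 0") auto
      qed
    next
      case False
      have "i = m + 1 \<and> (j = m + 2 \<or> j = m + 3 \<or> j = m + 4) \<or>
        i = m + 2 \<and> (j = m + 3 \<or> j = m + 4) \<or> i = m + 3 \<and> j = m + 4"
        using cases[OF i] cases[OF \<open>j < n\<close>] False \<open>i < j\<close> by (elim disjE conjE) simp_all
      then show ?thesis using fv dist by (elim disjE conjE) auto
    qed
  qed
  then have "inj_on f {0..<n}" by (intro linorder_inj_onI') auto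
  moreover have "f ` {0..<n} \<subseteq> V"
  proof
    fix y assume "y \<in> f ` {0..<n}"
    then obtain i where i: "i < n" "y = f i" by auto
    show "y \<in> V"
      using cases[OF i(1)] simple_graphD[OF sg edges(1)] simple_graphD[OF sg edges(2)]
        simple_graphD[OF sg edges(3)] simple_graphD[OF sg edges(4)] fv fg[of i] gS(1)[of i]
        simple_graph_nbhd(1)[OF sg, of v] i(2)
      by (elim disjE) auto
  qed
  moreover have "f ` e \<in> E" if "e \<in> T1_edges n" for e
  proof -
    have "T1_edges n = {{0, i} | i. 1 \<le> i \<and> i \<le> m + 2} \<union> {{m + 1, m + 3}, {m + 2, m + 4}}"
      by (simp add: T1_edges_def m add.commute)
    with that have "e \<in> {{0, i} | i. 1 \<le> i \<and> i \<le> m + 2} \<or> e = {m + 1, m + 3} \<or> e = {m + 2, m + 4}"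
      by (simp only: Un_iff insert_iff empty_iff simp_thms)
    then consider i where "1 \<le> i" "i \<le> m + 2" "e = {0, i}" | "e = {m + 1, m + 3}" | "e = {m + 2, m + 4}"
      by blast
    then show ?thesis
    proof cases
      case (1 i)
      then have "i \<le> m \<or> i = m + 1 \<or> i = m + 2" by linarith
      then have "{v, f i} \<in> E"
        using 1(1) fv fg[of i] gS(1)[of i] edges by (elim disjE) (simp_all add: nbhd_iff)
      then show ?thesis using 1(3) fv(1) by simp
    next
      case 2
      then show ?thesis using fv(2,4) edges(3) by (simp only: image_insert image_empty)
    next
      case 3
      then show ?thesis using fv(3,5) edges(4) by (simp only: image_insert image_empty)
    qed
  qed
  ultimately show ?thesis unfolding contains_graph_def T1_vertices_def by (intro exI[of _ f]) simp
qed

text \<open>Two disjoint legs use up \<open>x1\<close>, \<open>x2\<close> and those of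
  \<open>y1\<close>, \<open>y2\<close> that are neighbours of \<open>v\<close>; if
  \<open>n - 5\<close> neighbours remained, they would be the leaves of a copy.\<close>

lemma T1_free_disjoint_edges:
  assumes sg: "simple_graph V E" and n: "n \<ge> 5" and free: "T1_free n V E"
    and x: "x1 \<in> nbhd E v" "x2 \<in> nbhd E v" and edges: "{x1, y1} \<in> E" "{x2, y2} \<in> E"
    and dist: "distinct [v, x1, x2, y1, y2]"
  shows "card (nbhd E v) < n - 3 + card (nbhd E v \<inter> {y1, y2})"
proof (rule ccontr)
  assume *: "\<not> ?thesis"
  let ?N = "nbhd E v"
  let ?S = "?N - {x1, x2, y1, y2}"
  have fin: "finite ?N" using simple_graph_nbhd[OF sg] by blast
  have "?N \<inter> {x1, x2, y1, y2} = {x1, x2} \<union> (?N \<inter> {y1, y2})" using x by auto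
  then have "card (?N \<inter> {x1, x2, y1, y2}) \<le> 2 + card (?N \<inter> {y1, y2})"
    using card_Un_le[of "{x1, x2}" "?N \<inter> {y1, y2}"] dist by simp
  moreover have "card ?N = card ?S + card (?N \<inter> {x1, x2, y1, y2})"
    using fin card_Diff_subset_Int[of ?N "{x1, x2, y1, y2}"] card_mono[of ?N "?N \<inter> {x1, x2, y1, y2}"] by simp
  ultimately have "n - 5 \<le> card ?S" using * n by linarith
  then have "contains_graph V E (T1_vertices n) (T1_edges n)"
    using x edges dist fin by (intro T1_embedding[OF sg n, of ?S v x1 x2 y1 y2]) (auto simp: nbhd_iff)
  then show False using free by blast
qed

section \<open>The deficit function\<close>

text \<open>With \<open>q = n - 1\<close>, \<open>r * (q - r)\<close> is what disjoint complete
  graphs on \<open>q\<close> vertices and one on \<open>r\<close> vertices lose in degree sum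
  against degree \<open>q - 1\<close> everywhere. The alternative \<open>2 * (q + r)\<close> is the
  loss of a \<open>(q - 3)\<close>-regular graph on \<open>q + r\<close> vertices, an option only
  from \<open>q\<close> vertices on.\<close>

definition deficit :: "nat \<Rightarrow> nat \<Rightarrow> nat" where
  "deficit q p = (let r = p mod q in
     if p < q then r * (q - r) else min (r * (q - r)) (2 * (q + r)))"

lemma deficit_le: "deficit q p \<le> (p mod q) * (q - p mod q)"
  by (simp add: deficit_def Let_def)

lemma deficit_small: "p \<le> q \<Longrightarrow> deficit q p \<le> p * (q - p)"
  using deficit_le[of q p] by (cases "p = q") auto

lemma deficit_cases:
  "deficit q x = (x mod q) * (q - x mod q) \<or> deficit q x = 2 * (q + x mod q) \<and> x \<ge> q"
  by (simp add: deficit_def Let_def min_def)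

text \<open>Without wrap-around the two sides differ by \<open>2 * a * b\<close>; otherwise
  replacing each number by its complement to \<open>q\<close> leaves the parabola unchanged and
  gives the same computation.\<close>

lemma parabola_mod_subadditive:
  fixes a b q :: nat
  assumes "a < q" "b < q"
  shows "((a + b) mod q) * (q - (a + b) mod q) \<le> a * (q - a) + b * (q - b)"
proof (cases "a + b < q")
  case True
  then obtain c where c: "q = a + b + c" using less_imp_add_positive by blast
  then show ?thesis using True by (simp add: algebra_simps)
next
  case False
  obtain a' b' where ab: "q = a + a'" "q = b + b'" using assms by (metis less_imp_add_positive)
  obtain c where c: "a + b = q + c" using False by (metis le_add_diff_inverse not_less)
  have "(q + c) mod q = c" using c assms by simp
  then have "(a + b) mod q = c" by (simp only: c)
  moreover have a: "a = b' + c" and b: "b = a' + c" using ab c by auto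
  moreover have "q - c = a' + b'" "q - a = a'" "q - b = b'" using ab a b by auto
  ultimately show ?thesis by (simp add: algebra_simps)
qed

text \<open>Each summand is parabolic or linear in its residue: \<open>sum\<close> settles two
  parabolic ones, \<open>large\<close> one of each kind, \<open>both\<close> two linear
  ones.\<close>

lemma deficit_add:
  assumes q: "q > 0"
  shows "deficit q (x + y) \<le> deficit q x + deficit q y"
proof -
  define a b c where "a = x mod q" and "b = y mod q" and "c = (x + y) mod q"
  have lt: "a < q" "b < q" using q by (auto simp: a_def b_def)
  have c: "c = (a + b) mod q" by (simp add: a_def b_def c_def mod_add_eq)
  have sum: "deficit q (x + y) \<le> a * (q - a) + b * (q - b)"
    using deficit_le[of q "x + y"] parabola_mod_subadditive[OF lt] by (simp add: c_def[symmetric] c)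
  have large: "deficit q (x + y) \<le> 2 * (q + a) + b * (q - b)"
    if "a < q" "b < q" "c = (a + b) mod q" "x + y \<ge> q" for a b
  proof -
    have d: "deficit q (x + y) \<le> 2 * (q + c)" "deficit q (x + y) \<le> c * (q - c)"
      using that(4) by (auto simp: deficit_def Let_def c_def)
    show ?thesis
    proof (cases "a + b < q")
      case False
      have "(a + b) mod q = a + b - q" using False that by (simp add: mod_if)
      then have "c \<le> a" using that by simp
      then have "2 * (q + c) \<le> 2 * (q + a)" by simp
      then show ?thesis using d(1) by (meson le_trans trans_le_add1)
    next
      case True
      then have ab: "c = a + b" using that by simp
      show ?thesis
      \<comment> \<open>The term \<open>b * (q - b)\<close> pays for the extra \<open>2 * b\<close>
        unless \<open>q - b = 1\<close>; then \<open>a = 0\<close>, and the parabolic bound at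
        \<open>c = b\<close> is used instead.\<close>
      proof (cases "b + 1 = q")
        case True
        then have "a = 0" "q - b = 1" using \<open>a + b < q\<close> by auto
        then show ?thesis using d(2) ab by simp
      next
        case False
        then have "b * 2 \<le> b * (q - b)" using that by (intro mult_left_mono) auto
        then have "2 * (q + c) \<le> 2 * (q + a) + b * (q - b)" using ab by (simp add: mult.commute)
        then show ?thesis using d(1) by linarith
      qed
    qed
  qed
  have "c = (b + a) mod q" using c by (simp add: add.commute)
  have x: "deficit q x = a * (q - a) \<or> deficit q x = 2 * (q + a) \<and> x \<ge> q"
    unfolding a_def by (rule deficit_cases)
  have y: "deficit q y = b * (q - b) \<or> deficit q y = 2 * (q + b) \<and> y \<ge> q"
    unfolding b_def by (rule deficit_cases)
  have both: "deficit q (x + y) \<le> 2 * (q + a) + 2 * (q + b)" if "x \<ge> q"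
  proof -
    have "deficit q (x + y) \<le> 2 * (q + c)" using that by (simp add: deficit_def Let_def c_def)
    moreover have "c < q" using q by (simp add: c_def)
    ultimately show ?thesis by simp
  qed
  show ?thesis
    using x y sum both large[OF lt c] large[OF lt(2,1) \<open>c = (b + a) mod q\<close>]
    by (auto simp: add.commute)
qed

text \<open>As \<open>x \<ge> q + r\<close> for the residue \<open>r\<close>, the claim reduces to
  \<open>q * (q - 5) + (r - 2) * (r - 3) \<ge> 0\<close>, which holds over the integers.\<close>

lemma deficit_large:
  assumes "q \<ge> 5" "x \<ge> q"
  shows "deficit q x + 4 * x \<le> (q - 1) * x + 6"
proof -
  define r where "r = x mod q"
  have r: "r < q" using assms by (simp add: r_def)
  have "x div q \<ge> 1" using assms by (simp add: div_greater_zero_iff Suc_le_eq)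
  then have x: "x \<ge> q + r"
    by (metis r_def div_mult_mod_eq add_le_mono1 mult_le_mono1 mult_1)
  have "int r * (int q - int r) + 4 * int x \<le> (int q - 1) * int x + 6"
  proof -
    have "(int r - 2) * (int r - 3) \<ge> 0"
      by (cases "r \<le> 2") (auto intro: mult_nonneg_nonneg mult_nonpos_nonpos)
    moreover have "(int q - 5) * (int x - (int q + int r)) \<ge> 0" "(int q - 5) * int q \<ge> 0"
      using assms x by (auto intro!: mult_nonneg_nonneg)
    ultimately show ?thesis by (simp add: algebra_simps)
  qed
  then have "int (r * (q - r) + 4 * x) \<le> int ((q - 1) * x + 6)"
    using r assms by (simp add: of_nat_diff)
  then have "r * (q - r) + 4 * x \<le> (q - 1) * x + 6" by (simp only: of_nat_le_iff)
  then show ?thesis using deficit_le[of q x] unfolding r_def[symmetric] by linarith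
qed

section \<open>Upper bound\<close>

lemma handshake:
  assumes sg: "simple_graph V E"
  shows "(\<Sum>v\<in>V. card (nbhd E v)) = 2 * card E"
proof -
  have "card {v \<in> V. v \<in> e} = 2" if "e \<in> E" for e
  proof -
    have "e \<subseteq> V \<and> card e = 2"
      using simple_graph_edges_subset[OF sg] that by (auto simp: clique_def)
    moreover from this have "{v \<in> V. v \<in> e} = e" by blast
    ultimately show ?thesis by simp
  qed
  then have "(\<Sum>v\<in>V. card {e \<in> E. v \<in> e}) = (\<Sum>e\<in>E. 2)"
    using simple_graph_finite[OF sg] by (intro sum_multicount_gen) auto
  moreover have "{e \<in> E. v \<in> e} = touching E {v}" for v by (auto simp: touching_def)
  ultimately show ?thesis by (simp add: card_edges_at[OF sg])
qed

section \<open>Removable vertex sets\<close>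

lemma remove_vertices:
  assumes sg: "simple_graph V E" and X: "X \<subseteq> V"
  shows "simple_graph (V - X) (E - touching E X)"
    and "card E = card (E - touching E X) + card (touching E X)"
    and "card V = card (V - X) + card X"
proof -
  note fin = simple_graph_finite[OF sg]
  show "simple_graph (V - X) (E - touching E X)"
    unfolding simple_graph_def
  proof (intro conjI ballI)
    fix e assume e: "e \<in> E - touching E X"
    then obtain u v where "e = {u, v}" "u \<noteq> v" "u \<in> V" "v \<in> V"
      using sg unfolding simple_graph_def by blast
    moreover from this have "u \<notin> X" "v \<notin> X" using e by (auto simp: touching_def)
    ultimately show "\<exists>u v. e = {u, v} \<and> u \<noteq> v \<and> u \<in> V - X \<and> v \<in> V - X" by blast
  qed (use fin in simp)
  have "touching E X \<subseteq> E" by (auto simp: touching_def)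
  then show "card E = card (E - touching E X) + card (touching E X)"
    using fin by (simp add: card_Diff_subset finite_subset card_mono)
  show "card V = card (V - X) + card X"
    using fin X by (simp add: card_Diff_subset finite_subset card_mono)
qed

definition removable :: "nat \<Rightarrow> 'a set \<Rightarrow> 'a set set \<Rightarrow> 'a set \<Rightarrow> bool" where
  "removable n V E X \<longleftrightarrow> X \<subseteq> V \<and> X \<noteq> {} \<and>
     2 * card (touching E X) + deficit (n - 1) (card X) \<le> (n - 2) * card X"

text \<open>Write \<open>x\<close> for the size of \<open>X\<close>. The deficit is at most
  \<open>x * (n - 1 - x)\<close>, and together with the degree sum \<open>x * (x - 1)\<close> of a
  complete graph this is exactly \<open>(n - 2) * x\<close>.\<close>

lemma removableI_dense:
  assumes "X \<subseteq> V" "X \<noteq> {}" "card X < n"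
    and t: "2 * card (touching E X) \<le> card X * (card X - 1)"
  shows "removable n V E X"
proof (cases "card X = 0")
  case True
  then show ?thesis using assms by (simp add: removable_def deficit_def)
next
  case False
  let ?x = "card X"
  obtain y where y: "n = ?x + y + 1"
    using assms(3) less_imp_Suc_add by fastforce
  obtain x where x: "?x = Suc x" using False by (metis not0_implies_Suc)
  have "deficit (n - 1) ?x \<le> ?x * y"
    using deficit_small[of ?x "n - 1"] y by simp
  then have "2 * card (touching E X) + deficit (n - 1) ?x \<le> ?x * (?x - 1) + ?x * y"
    using t by linarith
  also have "\<dots> = (n - 2) * ?x" using x y by (simp add: algebra_simps)
  finally show ?thesis using assms by (simp add: removable_def)
qed

lemma removableI_closed:
  assumes sg: "simple_graph V E" and X: "X \<subseteq> V" "X \<noteq> {}" "card X < n"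
    and closed: "\<And>e. e \<in> touching E X \<Longrightarrow> e \<subseteq> X"
  shows "removable n V E X"
proof (rule removableI_dense[OF X])
  have fin: "finite X" using X simple_graph_finite[OF sg] by (auto intro: finite_subset)
  have "touching E X \<subseteq> clique X"
    using closed simple_graph_edges_subset[OF sg] by (auto simp: touching_def clique_def)
  then have "card (touching E X) \<le> card (clique X)"
    using card_clique(1)[OF fin] by (rule card_mono[rotated])
  then show "2 * card (touching E X) \<le> card X * (card X - 1)"
    using card_clique(2)[OF fin] by linarith
qed

text \<open>Serves vertices of high degree, around which fewer than two edges per removed vertex are
  lost. The estimate of the deficit needs \<open>n - 1 \<ge> 5\<close>, so \<open>n = 5\<close> is
  treated apart.\<close>

lemma removableI_sparse:
  assumes n: "n \<ge> 6" and X: "X \<subseteq> V" "card X \<ge> n - 1"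
    and t: "2 * card (touching E X) + 6 \<le> 4 * card X"
  shows "removable n V E X"
proof -
  have "n - 1 \<ge> 5" "n - 1 - 1 = n - 2" using n by simp_all
  then have "deficit (n - 1) (card X) + 4 * card X \<le> (n - 2) * card X + 6"
    using deficit_large[of "n - 1" "card X"] X(2) by (simp only:)
  then have "2 * card (touching E X) + deficit (n - 1) (card X) \<le> (n - 2) * card X"
    using t by linarith
  moreover have "X \<noteq> {}"
  proof
    assume "X = {}"
    then have "n - 1 \<le> 0" using X(2) by (simp only: card.empty)
    then show False using n by linarith
  qed
  ultimately show ?thesis using X(1) by (simp only: removable_def simp_thms)
qed

section \<open>Maximum degree at most \<open>n - 3\<close>\<close>

text \<open>Every vertex falls short of degree \<open>n - 2\<close> by at least 2, and the deficit
  is at most \<open>2 * card V\<close>.\<close>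

lemma removable_max_degree_small:
  assumes sg: "simple_graph V E" and n: "n \<ge> 5" and p: "card V \<ge> n - 1"
    and deg: "\<And>u. u \<in> V \<Longrightarrow> card (nbhd E u) \<le> n - 4"
  shows "removable n V E V"
proof -
  have "touching E V \<subseteq> E" by (auto simp: touching_def)
  then have "card (touching E V) \<le> card E"
    using simple_graph_finite[OF sg] by (intro card_mono)
  moreover have "2 * card E \<le> card V * (n - 4)"
    using handshake[OF sg] sum_bounded_above[of V "\<lambda>v. card (nbhd E v)" "n - 4"] deg by simp
  moreover have "deficit (n - 1) (card V) \<le> 2 * card V"
  proof -
    let ?q = "n - 1"
    have "card V div ?q \<ge> 1" using p n by (simp add: div_greater_zero_iff Suc_le_eq)
    then have "?q + card V mod ?q \<le> card V"
      by (metis div_mult_mod_eq add_le_mono1 mult_le_mono1 mult_1)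
    then show ?thesis using p by (auto simp: deficit_def Let_def)
  qed
  moreover have "(n - 2) * card V = card V * (n - 4) + 2 * card V"
  proof -
    have "n - 2 = (n - 4) + 2" using n by simp
    then show ?thesis by (simp add: algebra_simps)
  qed
  ultimately show ?thesis using n p by (auto simp: removable_def)
qed

text \<open>Two disjoint edges leaving the closed neighbourhood would be the legs of a copy, so all
  such edges share an end \<open>c\<close>. Once \<open>c\<close> is added to the closed
  neighbourhood, no more edges are touched than a complete graph on that set has.\<close>

lemma removable_degree_n_minus_3:
  assumes sg: "simple_graph V E" and n: "n \<ge> 5" and free: "T1_free n V E"
    and v: "v \<in> V" "card (nbhd E v) = n - 3"
    and deg: "\<And>u. card (nbhd E u) \<le> n - 3"
  shows "\<exists>X. removable n V E X"
proof -
  let ?N = "nbhd E v"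
  note N = simple_graph_nbhd[OF sg, of v]
  define cross where "cross x w \<longleftrightarrow> x \<in> ?N \<and> w \<notin> ?N \<and> w \<noteq> v \<and> {x, w} \<in> E" for x w
  \<comment> \<open>Inner ends are neighbours of \<open>v\<close> and outer ends are not, so two
    crossing edges can only meet in ends of the same kind, and no triangle arises.\<close>
  have meet: "x = x' \<or> w = w'" if "cross x w" "cross x' w'" for x w x' w'
  proof (rule ccontr)
    assume ne: "\<not> (x = x' \<or> w = w')"
    then have "distinct [v, x, x', w, w']" using that N(3) by (auto simp: cross_def)
    then show False
      using T1_free_disjoint_edges[OF sg n free, of x v x' w w'] that v(2) by (auto simp: cross_def)
  qed
  have "?N \<noteq> {}" using v n by auto
  then obtain x0 where x0: "x0 \<in> ?N" by blast
  have "\<exists>c. c \<in> V \<and> c \<noteq> v \<and> (\<forall>x w. cross x w \<longrightarrow> c = x \<or> c = w)"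
  proof (cases "\<exists>x w. cross x w")
    case False
    then show ?thesis using x0 N by blast
  next
    case True
    then obtain x w where xw: "cross x w" by blast
    then have V: "x \<in> V" "w \<in> V" "x \<noteq> v" "w \<noteq> v"
      using N simple_graphD[OF sg, of x w] by (auto simp: cross_def)
    show ?thesis
    proof (cases "\<forall>x' w'. cross x' w' \<longrightarrow> x' = x")
      case True
      then show ?thesis using V by blast
    next
      case False
      then obtain x' w' where x': "cross x' w'" "x' \<noteq> x" by blast
      then have "w' = w" using meet[OF xw x'(1)] by simp
      then have "w'' = w" if "cross x'' w''" for x'' w''
        using meet[OF xw that] meet[OF x'(1) that] x'(2) by auto
      then show ?thesis using V by blast
    qed
  qed
  then obtain c where c: "c \<in> V" "c \<noteq> v" "\<And>x w. cross x w \<Longrightarrow> c = x \<or> c = w" by blast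
  define X where "X = insert c (insert v ?N)"
  have X: "X \<subseteq> V" "X \<noteq> {}" using c(1) v(1) N(1) by (auto simp: X_def)
  have finX: "finite X" using N by (simp add: X_def)
  have card_X: "card X = n - 2 \<or> card X = n - 1"
  proof (cases "c \<in> ?N")
    case True
    then have "X = insert v ?N" by (auto simp: X_def)
    then have "card X = Suc (n - 3)" using N v(2) by simp
    then show ?thesis using n by linarith
  next
    case False
    then have "card X = Suc (Suc (n - 3))" using N v(2) c(2) by (simp add: X_def)
    then show ?thesis using n by linarith
  qed
  have "touching E X \<subseteq> clique (X - {c}) \<union> touching E {c}"
  proof
    fix e assume e: "e \<in> touching E X"
    show "e \<in> clique (X - {c}) \<union> touching E {c}"
    proof (cases "c \<in> e")
      case True
      then show ?thesis using e by (auto simp: touching_def)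
    next
      case False
      then obtain a where a: "a \<in> e" "a \<in> insert v ?N" "e \<in> E"
        using e by (auto simp: touching_def X_def)
      then obtain b where b: "e = {a, b}" "a \<noteq> b" using simple_graph_edgeE[OF sg] by metis
      have "b \<in> insert v ?N"
      proof (rule ccontr)
        assume nb: "b \<notin> insert v ?N"
        then have "a \<noteq> v" using a b by (auto simp: nbhd_iff)
        then have "cross a b" using a b nb by (auto simp: cross_def)
        then show False using c(3) b False by blast
      qed
      then have "e \<subseteq> X - {c}" using a b False by (auto simp: X_def)
      then show ?thesis using b by (simp add: clique_def)
    qed
  qed
  then have "card (touching E X) \<le> card (clique (X - {c})) + card (nbhd E c)"
    using finX by (intro card_le_add_touching[OF sg] card_clique) auto
  moreover have "2 * card (clique (X - {c})) = (card X - 1) * (card X - 1 - 1)"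
    using finX card_clique(2)[of "X - {c}"] card_Diff_singleton[of c X] by (simp add: X_def)
  \<comment> \<open>The maximum degree \<open>n - 3\<close> is at most \<open>card X - 1\<close>, so
    \<open>c\<close> counts as one more vertex of a complete graph.\<close>
  moreover have "card (nbhd E c) \<le> card X - 1" using deg[of c] card_X by linarith
  ultimately have "2 * card (touching E X) \<le> (card X - 1) * (card X - 1 - 1) + 2 * (card X - 1)"
    by linarith
  also have "\<dots> = card X * (card X - 1)"
  proof -
    have "card X \<ge> 2" using card_X n by linarith
    then obtain y where "card X = Suc (Suc y)" by (metis le_Suc_ex add_2_eq_Suc)
    then show ?thesis by simp
  qed
  finally have "removable n V E X" using X card_X n by (intro removableI_dense) linarith+
  then show ?thesis by blast
qed

section \<open>Maximum degree at least \<open>n - 2\<close>\<close>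

text \<open>Disjoint outer edges act as legs, which bounds the degree by \<open>n - 2\<close>, with
  equality only if both leg ends are neighbours of \<open>v\<close>. In that case each of them must
  also meet the given edge that leaves the closed neighbourhood, and they can do so only in its
  inner end.\<close>

lemma outer_edges_intersect:
  assumes sg: "simple_graph V E" and n: "n \<ge> 5" and free: "T1_free n V E"
    and big: "card (nbhd E v) \<ge> n - 1 \<or>
      card (nbhd E v) = n - 2 \<and> (\<exists>x\<in>nbhd E v. \<exists>w. w \<noteq> v \<and> w \<notin> nbhd E v \<and> {x, w} \<in> E)"
    and e: "e \<in> touching E (nbhd E v) - touching E {v}"
    and f: "f \<in> touching E (nbhd E v) - touching E {v}"
  shows "e \<inter> f \<noteq> {}"
proof
  assume disj: "e \<inter> f = {}"
  let ?N = "nbhd E v"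
  have fork: "card ?N < n - 3 + card (?N \<inter> {y1, y2})"
    if "x1 \<in> ?N" "x2 \<in> ?N" "{x1, y1} \<in> E" "{x2, y2} \<in> E" "v \<notin> {y1, y2}" "{x1, y1} \<inter> {x2, y2} = {}"
    for x1 x2 y1 y2
    using that simple_graphD(1)[OF sg that(3)] simple_graphD(1)[OF sg that(4)]
      simple_graph_nbhd(3)[OF sg, of v]
    by (intro T1_free_disjoint_edges[OF sg n free]) auto
  have outer: "\<exists>x y. e = {x, y} \<and> x \<in> ?N \<and> y \<noteq> v \<and> {x, y} \<in> E"
    if e: "e \<in> touching E ?N - touching E {v}" for e
  proof -
    obtain x where "x \<in> e" "x \<in> ?N" "e \<in> E" "v \<notin> e" using e by (auto simp: touching_def)
    moreover from this obtain y where "e = {x, y}" using simple_graph_edgeE[OF sg] by metis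
    ultimately show ?thesis by blast
  qed
  obtain x1 y1 where 1: "e = {x1, y1}" "x1 \<in> ?N" "y1 \<noteq> v" "{x1, y1} \<in> E" using outer[OF e] by blast
  obtain x2 y2 where 2: "f = {x2, y2}" "x2 \<in> ?N" "y2 \<noteq> v" "{x2, y2} \<in> E" using outer[OF f] by blast
  have lt: "card ?N < n - 3 + card (?N \<inter> {y1, y2})" using fork 1 2 disj by auto
  have two: "card (?N \<inter> {y1, y2}) \<le> 2"
    by (rule order_trans[OF card_mono[of "{y1, y2}"]]) (auto simp: card_insert_if)
  then obtain x w where xw: "card ?N = n - 2" "x \<in> ?N" "w \<noteq> v" "w \<notin> ?N" "{x, w} \<in> E"
    using big lt n by fastforce
  have one: "card (?N \<inter> {y, w}) \<le> 1" for y
  proof -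
    have "?N \<inter> {y, w} \<subseteq> {y}" using xw by auto
    then show ?thesis using card_mono[of "{y}"] by fastforce
  qed
  \<comment> \<open>With \<open>w\<close> outside the neighbourhood, at most one leg end is a
    neighbour, too few for degree \<open>n - 2\<close>.\<close>
  have meet: "{a, b} \<inter> {x, w} \<noteq> {}" if "a \<in> ?N" "b \<noteq> v" "{a, b} \<in> E" for a b
  proof
    assume "{a, b} \<inter> {x, w} = {}"
    then have "card ?N < n - 3 + card (?N \<inter> {b, w})" using that xw by (intro fork[of a x b w]) auto
    then show False using one[of b] xw(1) n by linarith
  qed
  have "card (?N \<inter> {y1, y2}) = 2" using lt two xw(1) n by linarith
  then have "y1 \<in> ?N" "y2 \<in> ?N"
    using card_mono[of "{y1}" "?N \<inter> {y1, y2}"] card_mono[of "{y2}" "?N \<inter> {y1, y2}"] by auto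
  then have "x \<in> e" "x \<in> f" using meet[of x1 y1] meet[of x2 y2] 1 2 xw(4) by auto
  then show False using disj by blast
qed

text \<open>The outer edges number at most three or share a point \<open>c\<close>. With
  \<open>d\<close> the degree of \<open>v\<close>, the \<open>d + 1\<close> vertices of the closed
  neighbourhood touch at most \<open>d + 3\<close> edges, or at most \<open>2 * d - 1\<close> if
  \<open>c\<close> is among them; adding a \<open>c\<close> from outside gives \<open>d + 2\<close>
  vertices and at most \<open>2 * d\<close> edges.\<close>

lemma removable_degree_large:
  assumes sg: "simple_graph V E" and n: "n \<ge> 6"
    and v: "v \<in> V" "card (nbhd E v) \<ge> n - 2"
    and deg: "\<And>u. card (nbhd E u) \<le> card (nbhd E v)"
    and inter: "\<And>e f. e \<in> touching E (nbhd E v) - touching E {v} \<Longrightarrow>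
      f \<in> touching E (nbhd E v) - touching E {v} \<Longrightarrow> e \<inter> f \<noteq> {}"
  shows "\<exists>X. removable n V E X"
proof -
  let ?N = "nbhd E v" and ?F = "touching E (nbhd E v) - touching E {v}"
  let ?d = "card (nbhd E v)"
  note fin = simple_graph_finite[OF sg]
  note N = simple_graph_nbhd[OF sg, of v]
  have pairs: "card e = 2" if "e \<in> ?F" for e
    using that simple_graph_edges_subset[OF sg] by (auto simp: touching_def clique_def)
  have finF: "finite ?F" using fin by (simp add: finite_touching)
  consider "card ?F \<le> 3" | c where "?F \<noteq> {}" "\<forall>e\<in>?F. c \<in> e"
    using intersecting_pairs[of ?F, OF pairs inter] by (metis card.empty zero_le)
  then show ?thesis
  proof cases
    case 1
    have "touching E (insert v ?N) \<subseteq> ?F \<union> touching E {v}" by (auto simp: touching_def)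
    then have "card (touching E (insert v ?N)) \<le> card ?F + ?d"
      using finF by (intro card_le_add_touching[OF sg])
    then have "removable n V E (insert v ?N)"
      using 1 v n N by (intro removableI_sparse) auto
    then show ?thesis by blast
  next
    case 2
    obtain e where "e \<in> ?F" using 2(1) by blast
    then have "c \<in> e" "e \<in> E" "v \<notin> e" using 2(2) by (auto simp: touching_def)
    then have c: "c \<in> V" "c \<noteq> v" using simple_graph_edges_subset[OF sg] by (auto simp: clique_def)
    let ?X = "insert c (insert v ?N)"
    have "touching E ?X \<subseteq> touching E {v} \<union> touching E {c}"
      using 2(2) by (fastforce simp: touching_def)
    show ?thesis
    proof (cases "c \<in> ?N")
      case True
      \<comment> \<open>The edge \<open>{v, c}\<close> must not be counted twice: the bound
        \<open>2 * d - 1\<close> meets the sparse criterion with equality.\<close>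
      have "touching E ?X \<subseteq> (touching E {v} - {{v, c}}) \<union> touching E {c}"
        using \<open>touching E ?X \<subseteq> touching E {v} \<union> touching E {c}\<close> by (auto simp: touching_def)
      then have "card (touching E ?X) \<le> card (touching E {v} - {{v, c}}) + card (nbhd E c)"
        using fin by (intro card_le_add_touching[OF sg]) (simp_all add: finite_touching)
      moreover have "{v, c} \<in> touching E {v}" using True by (simp add: touching_def nbhd_iff)
      then have "card (touching E {v} - {{v, c}}) = ?d - 1"
        by (simp add: card_edges_at[OF sg])
      moreover have "?X = insert v ?N" using True by auto
      ultimately have "removable n V E ?X"
        using deg[of c] v n N by (intro removableI_sparse) auto
      then show ?thesis by blast
    next
      case False
      have "card (touching E ?X) \<le> card (touching E {v}) + card (nbhd E c)"
        using fin \<open>touching E ?X \<subseteq> touching E {v} \<union> touching E {c}\<close>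
        by (intro card_le_add_touching[OF sg]) (simp_all add: finite_touching)
      then have "removable n V E ?X"
        using deg[of c] v n N c False
        by (intro removableI_sparse) (auto simp: card_edges_at[OF sg])
      then show ?thesis by blast
    qed
  qed
qed

text \<open>The closed neighbourhood is a connected component with at most \<open>n - 1\<close>
  vertices.\<close>

lemma removable_closed_nbhd:
  assumes sg: "simple_graph V E" and v: "v \<in> V" "card (nbhd E v) < n - 1"
    and closed: "\<And>x w. x \<in> nbhd E v \<Longrightarrow> {x, w} \<in> E \<Longrightarrow> w = v \<or> w \<in> nbhd E v"
  shows "removable n V E (insert v (nbhd E v))"
proof (rule removableI_closed[OF sg])
  note N = simple_graph_nbhd[OF sg, of v]
  show "insert v (nbhd E v) \<subseteq> V" "card (insert v (nbhd E v)) < n" using N v by auto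
  fix e assume "e \<in> touching E (insert v (nbhd E v))"
  then obtain a where "a \<in> e" "e \<in> E" "a = v \<or> a \<in> nbhd E v" by (auto simp: touching_def)
  moreover from this obtain b where "e = {a, b}" using simple_graph_edgeE[OF sg] by metis
  ultimately show "e \<subseteq> insert v (nbhd E v)" using closed[of a b] by (auto simp: nbhd_iff)
qed simp

section \<open>The case \<open>n = 5\<close>\<close>

text \<open>For \<open>n = 5\<close>, a set of at least three vertices is thereby removable as soon
  as it touches no more edges than it has vertices.\<close>

lemma deficit_four: "x \<ge> 3 \<Longrightarrow> deficit 4 x \<le> x"
proof (cases "x = 3")
  case False
  assume "x \<ge> 3"
  have "x mod 4 \<in> {0, 1, 2, 3}" by auto
  then have "(x mod 4) * (4 - x mod 4) \<le> 4" by auto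
  then show ?thesis using deficit_le[of 4 x] False \<open>x \<ge> 3\<close> by linarith
qed (simp add: deficit_def)

text \<open>The tree is the path on five vertices. If two neighbours \<open>a\<close>,
  \<open>b\<close> of \<open>v\<close> are adjacent, \<open>{a, b}\<close> is the only edge that
  touches the closed neighbourhood and avoids \<open>v\<close>. Otherwise the outer edges all start
  at one neighbour \<open>c\<close>, and with \<open>c\<close> kept in the graph only edges at
  \<open>v\<close> are lost.\<close>

lemma removable_path:
  assumes sg: "simple_graph V E" and free: "T1_free 5 V E"
    and v: "v \<in> V" "card (nbhd E v) \<ge> 3"
    and big: "card (nbhd E v) \<ge> 4 \<or>
      (\<exists>x\<in>nbhd E v. \<exists>w. w \<noteq> v \<and> w \<notin> nbhd E v \<and> {x, w} \<in> E)"
  shows "\<exists>X. removable 5 V E X"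
proof -
  let ?N = "nbhd E v"
  let ?d = "card ?N"
  note N = simple_graph_nbhd[OF sg, of v]
  have path: False if "distinct [a, b, c, d, e]" "{a, b} \<in> E" "{b, c} \<in> E" "{c, d} \<in> E" "{d, e} \<in> E"
    for a b c d e
    using T1_embedding[OF sg, of 5 "{}" c b d a e] that free by (auto simp: insert_commute)
  have third: "\<exists>z\<in>?N. z \<noteq> a \<and> z \<noteq> b" for a b
  proof -
    have "\<not> ?N \<subseteq> {a, b}" using card_mono[of "{a, b}" ?N] v(2) by (auto simp: card_insert_if split: if_splits)
    then show ?thesis by blast
  qed
  have fourth: "\<exists>z\<in>?N. z \<noteq> a \<and> z \<noteq> b \<and> z \<noteq> c" if "?d \<ge> 4 \<or> c \<notin> ?N" for a b c
  proof (cases "c \<in> ?N")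
    case True
    then have "\<not> ?N \<subseteq> {a, b, c}"
      using card_mono[of "{a, b, c}" ?N] that by (auto simp: card_insert_if split: if_splits)
    then show ?thesis by blast
  qed (use third[of a b] in blast)
  have edge_v: "{v, x} \<in> E" "{x, v} \<in> E" "x \<noteq> v" if "x \<in> ?N" for x
    using that N(3) by (auto simp: nbhd_iff insert_commute)
  show ?thesis
  proof (cases "\<exists>a b. a \<in> ?N \<and> b \<in> ?N \<and> {a, b} \<in> E")
    case True
    then obtain a b where ab: "a \<in> ?N" "b \<in> ?N" "{a, b} \<in> E" by blast
    have "a \<noteq> b" using simple_graphD[OF sg ab(3)] by simp
    have side: False if "a \<in> ?N" "b \<in> ?N" "{a, b} \<in> E" "{a, u} \<in> E" "u \<noteq> v" "u \<noteq> b"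
      and u: "?d \<ge> 4 \<or> u \<notin> ?N" for a b u
    proof -
      obtain z where z: "z \<in> ?N" "z \<noteq> a" "z \<noteq> b" "z \<noteq> u" using fourth[OF u] by blast
      show False
        using z that edge_v simple_graphD(1)[OF sg that(3)] simple_graphD(1)[OF sg that(4)]
        by (intro path[of u a b v z]) (auto simp: insert_commute[of u a])
    qed
    have ba: "{b, a} \<in> E" using ab(3) by (simp add: insert_commute)
    have away: False if "c \<in> ?N" "c \<noteq> a" "c \<noteq> b" "{c, u} \<in> E" "u \<noteq> v" "u \<noteq> a" "u \<noteq> b" for c u
      using that ab ba edge_v \<open>a \<noteq> b\<close> simple_graphD(1)[OF sg that(4)]
      by (intro path[of b a v c u]) auto
    \<comment> \<open>For degree 3 the hypothesis gives an edge out of the closed neighbourhood, and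
      from whichever neighbour it starts, a path on five vertices appears.\<close>
    have d: "?d \<ge> 4"
    proof (rule ccontr)
      assume "\<not> ?d \<ge> 4"
      then obtain x w where "x \<in> ?N" "w \<noteq> v" "w \<notin> ?N" "{x, w} \<in> E" using big by blast
      then show False using side[OF ab, of w] side[OF ab(2,1) ba, of w] away[of x w] ab by metis
    qed
    have "touching E (insert v ?N) \<subseteq> {{a, b}} \<union> touching E {v}"
    proof
      fix e assume e: "e \<in> touching E (insert v ?N)"
      show "e \<in> {{a, b}} \<union> touching E {v}"
      proof (cases "v \<in> e")
        case False
        then obtain x where x: "x \<in> e" "x \<in> ?N" "e \<in> E" using e by (auto simp: touching_def)
        then obtain y where y: "e = {x, y}" using simple_graph_edgeE[OF sg] by metis
        have "y \<noteq> v" "{x, y} \<in> E" "{y, x} \<in> E" using x y False by (auto simp: insert_commute)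
        have "x = a \<Longrightarrow> y = b" using side[OF ab, of y] \<open>y \<noteq> v\<close> \<open>{x, y} \<in> E\<close> d by blast
        moreover have "x = b \<Longrightarrow> y = a"
          using side[OF ab(2,1) ba, of y] \<open>y \<noteq> v\<close> \<open>{x, y} \<in> E\<close> d by blast
        moreover have "x = a \<or> x = b"
        proof (rule ccontr)
          assume nx: "\<not> (x = a \<or> x = b)"
          then have "y = a \<or> y = b" using away[of x y] x(2) \<open>{x, y} \<in> E\<close> \<open>y \<noteq> v\<close> by blast
          then show False
            using side[OF ab, of x] side[OF ab(2,1) ba, of x] \<open>{y, x} \<in> E\<close> nx d edge_v(3)[OF x(2)]
            by blast
        qed
        ultimately show ?thesis using y by auto
      qed (use e in \<open>auto simp: touching_def\<close>)
    qed
    then have "card (touching E (insert v ?N)) \<le> card {{a, b}} + ?d"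
      by (intro card_le_add_touching[OF sg]) auto
    moreover have "card (insert v ?N) = ?d + 1" using N by simp
    ultimately have "removable 5 V E (insert v ?N)"
      using deficit_four[of "?d + 1"] d v(1) N(1) by (auto simp: removable_def)
    then show ?thesis by blast
  next
    case False
    define outer where "outer x w \<longleftrightarrow> x \<in> ?N \<and> w \<noteq> v \<and> {x, w} \<in> E" for x w
    have notN: "w \<notin> ?N" "w \<noteq> x" "x \<noteq> v" if "outer x w" for x w
      using that False edge_v(3) simple_graphD(1)[OF sg, of x w] by (auto simp: outer_def)
    have same: "x = x'" if "outer x w" "outer x' w'" for x w x' w'
    proof (rule ccontr)
      assume ne: "x \<noteq> x'"
      obtain z where z: "z \<in> ?N" "z \<noteq> x" "z \<noteq> x'" using third by blast
      show False
      \<comment> \<open>With a common outer end the path starts at a third neighbour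
        \<open>z\<close>; with distinct ones it runs from \<open>w\<close> through \<open>v\<close>
        to \<open>w'\<close>.\<close>
      proof (cases "w = w'")
        case True
        then show False
          using z that notN[OF that(1)] notN[OF that(2)] ne edge_v
          by (intro path[of z v x w x']) (auto simp: outer_def insert_commute[of w' x'])
      next
        case w: False
        then show False
          using that notN[OF that(1)] notN[OF that(2)] ne edge_v
          by (intro path[of w x v x' w']) (auto simp: outer_def insert_commute[of w x])
      qed
    qed
    obtain c where c: "c \<in> ?N" "\<And>x w. outer x w \<Longrightarrow> x = c"
    proof (cases "\<exists>x w. outer x w")
      case True
      then show ?thesis using that same by (metis outer_def)
    next
      case no: False
      then show ?thesis using that third by blast
    qed
    let ?X = "insert v (?N - {c})"
    have "touching E ?X \<subseteq> {} \<union> touching E {v}"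
    proof
      fix e assume e: "e \<in> touching E ?X"
      show "e \<in> {} \<union> touching E {v}"
      proof (rule ccontr)
        assume "e \<notin> {} \<union> touching E {v}"
        then obtain x where x: "x \<in> e" "x \<in> ?N" "x \<noteq> c" "e \<in> E" "v \<notin> e" using e by (auto simp: touching_def)
        then obtain y where "e = {x, y}" using simple_graph_edgeE[OF sg] by metis
        then have "outer x y" using x by (auto simp: outer_def)
        then show False using c(2) x(3) by blast
      qed
    qed
    then have "card (touching E ?X) \<le> card ({} :: 'a set set) + ?d"
      by (intro card_le_add_touching[OF sg]) auto
    moreover have "card ?X = ?d" using N c(1) v(2) by simp
    ultimately have "removable 5 V E ?X"
      using deficit_four[of ?d] v N(1) by (auto simp: removable_def)
    then show ?thesis by blast
  qed
qed

lemma exists_removable: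
  assumes sg: "simple_graph V E" and n: "n \<ge> 5" and free: "T1_free n V E" and p: "card V \<ge> n - 1"
  shows "\<exists>X. removable n V E X"
proof -
  have "finite V" "V \<noteq> {}" using simple_graph_finite[OF sg] p n by auto
  then obtain v where v: "v \<in> V" "\<And>u. u \<in> V \<Longrightarrow> card (nbhd E u) \<le> card (nbhd E v)"
    using obtains_MAX[of V "\<lambda>u. card (nbhd E u)"] by (metis Max_ge finite_imageI imageI)
  have deg: "card (nbhd E u) \<le> card (nbhd E v)" for u
  proof (cases "u \<in> V")
    case False
    then have "nbhd E u = {}" using simple_graphD(2)[OF sg] by (auto simp: nbhd_def)
    then show ?thesis by simp
  qed (rule v(2))
  let ?cross = "\<exists>x\<in>nbhd E v. \<exists>w. w \<noteq> v \<and> w \<notin> nbhd E v \<and> {x, w} \<in> E"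
  \<comment> \<open>Degree \<open>n - 2\<close> is split because without a crossing edge the outer
    edges need not intersect; the closed neighbourhood is then a component.\<close>
  consider "card (nbhd E v) \<le> n - 4" | "card (nbhd E v) = n - 3"
    | "card (nbhd E v) = n - 2" "\<not> ?cross"
    | "card (nbhd E v) \<ge> n - 1 \<or> card (nbhd E v) = n - 2 \<and> ?cross"
    using n by linarith
  then show ?thesis
  proof cases
    case 1
    then show ?thesis using removable_max_degree_small[OF sg n p] deg le_trans by blast
  next
    case 2
    then show ?thesis using removable_degree_n_minus_3[OF sg n free v(1)] deg by simp
  next
    case 3
    then show ?thesis using removable_closed_nbhd[OF sg v(1), of n] n by force
  next
    case 4
    show ?thesis
    proof (cases "n = 5")
      case True
      then show ?thesis using removable_path[OF sg _ v(1)] free 4 by force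
    next
      case False
      then show ?thesis
        using removable_degree_large[OF sg _ v(1), of n] outer_edges_intersect[OF sg n free 4] deg 4 n
        by auto
    qed
  qed
qed

text \<open>Edge and vertex counts add up when a removable set is split off, and
  \<open>deficit_add\<close> merges the two deficits. The doubled, additive form avoids subtraction
  and rounding.\<close>

theorem T1_free_edge_bound:
  assumes "simple_graph V E" "n \<ge> 5" "T1_free n V E"
  shows "2 * card E + deficit (n - 1) (card V) \<le> (n - 2) * card V"
  using assms
proof (induction "card V" arbitrary: V E rule: less_induct)
  case less
  note sg = less.prems(1) and n = less.prems(2)
  have "\<exists>X. removable n V E X" if "V \<noteq> {}"
  proof (cases "card V \<ge> n - 1")
    case True
    then show ?thesis using exists_removable[OF sg n less.prems(3)] by blast
  next
    case False
    have "e \<subseteq> V" if "e \<in> touching E V" for e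
      using that simple_graph_edges_subset[OF sg] by (auto simp: touching_def clique_def)
    then have "removable n V E V" using False that by (intro removableI_closed[OF sg]) auto
    then show ?thesis by blast
  qed
  show ?case
  proof (cases "V = {}")
    case True
    then show ?thesis using simple_graph_edges_subset[OF sg] by (auto simp: deficit_def card_eq_0_iff clique_def)
  next
    case False
    then obtain X where X: "X \<subseteq> V" "X \<noteq> {}"
      "2 * card (touching E X) + deficit (n - 1) (card X) \<le> (n - 2) * card X"
      using \<open>V \<noteq> {} \<Longrightarrow> \<exists>X. removable n V E X\<close> by (auto simp: removable_def)
    note rem = remove_vertices[OF sg X(1)]
    have "card X > 0" using X simple_graph_finite[OF sg] by (simp add: card_gt_0_iff finite_subset)
    then have "2 * card (E - touching E X) + deficit (n - 1) (card (V - X)) \<le> (n - 2) * card (V - X)"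
      using rem(3) less.prems(3) contains_graph_mono[of "V - X" "E - touching E X" _ _ V E]
      by (intro less.hyps rem(1) n) auto
    moreover have "deficit (n - 1) (card (V - X) + card X) \<le>
        deficit (n - 1) (card (V - X)) + deficit (n - 1) (card X)"
      using n by (intro deficit_add) simp
    ultimately show ?thesis
      using X(3) unfolding rem(2) rem(3) add_mult_distrib2 by linarith
  qed
qed

section \<open>Lower bound\<close>

lemma T1_edgesI: "1 \<le> i \<Longrightarrow> i \<le> n - 3 \<Longrightarrow> {0, i} \<in> T1_edges n"
  by (auto simp: T1_edges_def)

text \<open>The centre of the tree has \<open>n - 3\<close> neighbours.\<close>

lemma T1_free_max_degree:
  assumes sg: "simple_graph V E" and n: "n \<ge> 5" and deg: "\<And>v. card (nbhd E v) \<le> n - 4"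
  shows "T1_free n V E"
proof
  assume "contains_graph V E (T1_vertices n) (T1_edges n)"
  then obtain f where f: "inj_on f {0..<n}" "\<And>e. e \<in> T1_edges n \<Longrightarrow> f ` e \<in> E"
    unfolding T1_vertices_def by (rule contains_graphE) (rule that)
  have "f ` {1..n - 3} \<subseteq> nbhd E (f 0)"
    using f(2)[OF T1_edgesI] by (auto simp: nbhd_iff)
  then have "card (f ` {1..n - 3}) \<le> card (nbhd E (f 0))"
    using simple_graph_nbhd(2)[OF sg] by (intro card_mono)
  moreover have "inj_on f {1..n - 3}" using f(1) by (rule inj_on_subset) auto
  then have "card (f ` {1..n - 3}) = n - 3" by (simp add: card_image)
  ultimately show False using deg[of "f 0"] n by linarith
qed

lemma T1_free_card:
  assumes "finite V" "card V < n"
  shows "T1_free n V E"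
proof
  assume "contains_graph V E (T1_vertices n) (T1_edges n)"
  then obtain f where "inj_on f {0..<n}" "f ` {0..<n} \<subseteq> V"
    unfolding T1_vertices_def by (rule contains_graphE) (rule that)
  then have "card {0..<n} \<le> card V" using assms(1) by (rule card_inj_on_le)
  then show False using assms(2) by simp
qed

section \<open>Adding disjoint complete graphs\<close>

lemma clique_mono: "A \<subseteq> B \<Longrightarrow> clique A \<subseteq> clique B"
  by (auto simp: clique_def)

lemma simple_graph_clique:
  assumes "finite A"
  shows "simple_graph A (clique A)"
  unfolding simple_graph_def
proof (intro conjI ballI)
  fix e assume "e \<in> clique A"
  then have "e \<subseteq> A" "card e = 2" by (simp_all add: clique_def)
  moreover from this obtain u v where "e = {u, v}" "u \<noteq> v" by (meson card_2_iff)
  ultimately show "\<exists>u v. e = {u, v} \<and> u \<noteq> v \<and> u \<in> A \<and> v \<in> A" by blast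
qed fact

lemma simple_graph_iff: "simple_graph V E \<longleftrightarrow> finite V \<and> E \<subseteq> clique V"
proof
  assume "simple_graph V E"
  then show "finite V \<and> E \<subseteq> clique V"
    using simple_graph_finite(1) simple_graph_edges_subset by metis
next
  assume "finite V \<and> E \<subseteq> clique V"
  moreover from this have "simple_graph V (clique V)" by (simp add: simple_graph_clique)
  ultimately show "simple_graph V E" unfolding simple_graph_def by (meson subsetD)
qed

text \<open>The tree is connected, so a copy lies wholly in the old graph or wholly in the new part,
  which has one vertex too few.\<close>

lemma add_clique:
  assumes sg: "simple_graph {0..<p} E" and n: "n \<ge> 5" and free: "T1_free n {0..<p} E"
  defines "K \<equiv> {p..<p + (n - 1)}"
  shows "simple_graph {0..<p + (n - 1)} (E \<union> clique K)"
    and "T1_free n {0..<p + (n - 1)} (E \<union> clique K)"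
    and "2 * card (E \<union> clique K) = 2 * card E + (n - 1) * (n - 2)"
proof -
  have E: "e \<subseteq> {0..<p}" "card e = 2" if "e \<in> E" for e
    using simple_graph_edges_subset[OF sg] that by (auto simp: clique_def)
  show "simple_graph {0..<p + (n - 1)} (E \<union> clique K)"
    using sg clique_mono[of "{0..<p}" "{0..<p + (n - 1)}"] clique_mono[of K "{0..<p + (n - 1)}"]
    by (auto simp: simple_graph_iff K_def)
  have "E \<inter> clique K = {}"
  proof -
    have False if "e \<in> E" "e \<in> clique K" for e
    proof -
      have "e \<subseteq> {0..<p} \<inter> K" using E[OF that(1)] that(2) by (auto simp: clique_def)
      then have "e = {}" by (auto simp: K_def)
      then show False using E(2)[OF that(1)] by simp
    qed
    then show ?thesis by blast
  qed
  then have "card (E \<union> clique K) = card E + card (clique K)"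
    using simple_graph_finite(2)[OF sg] card_clique(1)[of K]
    by (intro card_Un_disjoint) (auto simp: K_def)
  moreover have "n - 1 - 1 = n - 2" by simp
  then have "2 * card (clique K) = (n - 1) * (n - 2)"
    using card_clique(2)[of K] by (simp add: K_def)
  ultimately show "2 * card (E \<union> clique K) = 2 * card E + (n - 1) * (n - 2)"
    by simp
  show "T1_free n {0..<p + (n - 1)} (E \<union> clique K)"
  proof
    assume "contains_graph {0..<p + (n - 1)} (E \<union> clique K) (T1_vertices n) (T1_edges n)"
    then obtain f where f: "inj_on f {0..<n}" "f ` {0..<n} \<subseteq> {0..<p + (n - 1)}"
      "\<And>e. e \<in> T1_edges n \<Longrightarrow> f ` e \<in> E \<union> clique K"
      unfolding T1_vertices_def by (rule contains_graphE) (rule that)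
    have side: "f a < p \<longleftrightarrow> f b < p" if ab: "{a, b} \<in> T1_edges n" for a b
    proof -
      have "{f a, f b} \<in> E \<union> clique K" using f(3)[OF ab] by simp
      then have "{f a, f b} \<subseteq> {0..<p} \<or> {f a, f b} \<subseteq> K"
        using E(1)[of "{f a, f b}"] by (auto simp: clique_def)
      then show ?thesis by (auto simp: K_def)
    qed
    have near: "f i < p \<longleftrightarrow> f 0 < p" if "i \<le> n - 3" for i
      using side[OF T1_edgesI[of i n]] that by (cases "i = 0") auto
    have all: "f i < p \<longleftrightarrow> f 0 < p" if "i < n" for i
    proof -
      have e: "{n - 4, n - 2} \<in> T1_edges n" "{n - 3, n - 1} \<in> T1_edges n" by (simp_all add: T1_edges_def)
      have "f (n - 4) < p \<longleftrightarrow> f 0 < p" "f (n - 3) < p \<longleftrightarrow> f 0 < p"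
        by (intro near; simp)+
      moreover have "i \<le> n - 3 \<or> i = n - 2 \<or> i = n - 1" using that by presburger
      ultimately show ?thesis using near[of i] side[OF e(1)] side[OF e(2)] by metis
    qed
    show False
    proof (cases "f 0 < p")
      case True
      then have V: "f ` {0..<n} \<subseteq> {0..<p}" using all by auto
      have "f ` e \<in> E" if e: "e \<in> T1_edges n" for e
      proof (rule ccontr)
        assume "f ` e \<notin> E"
        then have "f ` e \<in> clique K" using f(3)[OF e] by blast
        moreover have "f ` e \<subseteq> {0..<p}"
        proof -
          have "e \<subseteq> {0..<n}" using e n by (auto simp: T1_edges_def)
          then show ?thesis using V by (meson image_mono order_trans)
        qed
        ultimately have "f ` e \<subseteq> {0..<p} \<inter> K" by (simp add: clique_def)
        then have "f ` e = {}" by (simp add: K_def)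
        then show False using \<open>f ` e \<in> clique K\<close> by (simp add: clique_def)
      qed
      then have "contains_graph {0..<p} E (T1_vertices n) (T1_edges n)"
        using f(1) V unfolding contains_graph_def T1_vertices_def by (intro exI[of _ f]) simp
      then show False using free by simp
    next
      case False
      have "f i \<in> K" if "i < n" for i
      proof -
        have "f i \<in> f ` {0..<n}" using that by simp
        then have "f i \<in> {0..<p + (n - 1)}" using f(2) by blast
        then show ?thesis using all[OF that] False by (simp add: K_def)
      qed
      then have "f ` {0..<n} \<subseteq> K" by auto
      then have "card {0..<n} \<le> card K" using f(1) by (intro card_inj_on_le) (auto simp: K_def)
      moreover have "card {0..<n} = n" "card K = n - 1" by (simp_all add: K_def)
      ultimately show False using n by linarith
    qed
  qed
qed

lemma add_cliques:
  assumes "simple_graph {0..<p} E" "n \<ge> 5" "T1_free n {0..<p} E"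
  shows "\<exists>E'. simple_graph {0..<p + k * (n - 1)} E' \<and> T1_free n {0..<p + k * (n - 1)} E' \<and>
    2 * card E' = 2 * card E + k * ((n - 1) * (n - 2))"
proof (induction k)
  case 0
  show ?case using assms by auto
next
  case (Suc k)
  then obtain E' where "simple_graph {0..<p + k * (n - 1)} E'" "T1_free n {0..<p + k * (n - 1)} E'"
    "2 * card E' = 2 * card E + k * ((n - 1) * (n - 2))" by blast
  note E' = add_clique[OF this(1) assms(2) this(2)] this(3)
  have p: "p + k * (n - 1) + (n - 1) = p + Suc k * (n - 1)"
    and m: "2 * card E + k * ((n - 1) * (n - 2)) + (n - 1) * (n - 2) =
      2 * card E + Suc k * ((n - 1) * (n - 2))" by simp_all
  have "2 * card (E' \<union> clique {p + k * (n - 1)..<p + k * (n - 1) + (n - 1)}) =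
      2 * card E + Suc k * ((n - 1) * (n - 2))"
    using E'(3,4) m by linarith
  then show ?case using E'(1,2) unfolding p by blast
qed

text \<open>
  A circulant graph with jumps \<open>1, \<dots>, d div 2\<close>, together with the matching of jump \<open>N div 2\<close>
  if \<open>d\<close> is odd.
\<close>

lemma near_regular_graph:
  assumes N: "d + 2 \<le> N"
  shows "\<exists>E. simple_graph {0..<N} E \<and> (\<forall>v. card (nbhd E v) \<le> d) \<and> card E = (d * N) div 2"
proof -
  define h where "h = d div 2"
  define M where "M = N div 2"
  have hM: "h < M" "2 * M \<le> N" "N \<le> 2 * M + 1" using N by (auto simp: h_def M_def)
  \<comment> \<open>Elements of \<open>P\<close> are pairs of a start and a jump. Jumps by
    \<open>M\<close> start only below \<open>M\<close>, so that each edge of the matching is listed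
    once; for odd \<open>N\<close> one vertex stays unmatched.\<close>
  define Q where "Q = (if odd d then {0..<M} \<times> {M} else {})"
  define P where "P = {0..<N} \<times> {1..h} \<union> Q"
  define s where "s i j = (if i + j < N then i + j else i + j - N)" for i j
  have P: "i < N \<and> 1 \<le> j \<and> j \<le> M \<and> (j = M \<longrightarrow> i < M)" if "(i, j) \<in> P" for i j
    using that hM by (auto simp: P_def Q_def split: if_splits)
  have s: "s i j < N" "s i j \<noteq> i" if "(i, j) \<in> P" for i j
    using P[OF that] hM by (auto simp: s_def)
  define E where "E = (\<lambda>(i, j). {i, s i j}) ` P"
  have sg: "simple_graph {0..<N} E"
    unfolding simple_graph_def
  proof (intro conjI ballI)
    fix e assume "e \<in> E"
    then obtain i j where "(i, j) \<in> P" "e = {i, s i j}" by (auto simp: E_def)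
    then show "\<exists>u v. e = {u, v} \<and> u \<noteq> v \<and> u \<in> {0..<N} \<and> v \<in> {0..<N}"
      using P s by (intro exI[of _ i] exI[of _ "s i j"]) (auto dest: not_sym)
  qed simp
  have "inj_on (\<lambda>(i, j). {i, s i j}) P"
  proof (rule inj_onI, clarify)
    fix i j i' j' assume p: "(i, j) \<in> P" "(i', j') \<in> P" and eq: "{i, s i j} = {i', s i' j'}"
    show "i = i' \<and> j = j'"
    proof (cases "i = i'")
      case True
      then have "s i j = s i j'" using eq by (auto simp: doubleton_eq_iff)
      moreover have "i < N" "j < N" "j' < N" using P[OF p(1)] P[OF p(2)] True hM by auto
      ultimately have "j = j'" unfolding s_def by (simp split: if_splits)
      then show ?thesis using True by simp
    next
      case False
      then have eqs: "i = s i' j'" "s i j = i'" using eq unfolding doubleton_eq_iff by blast+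
      have b: "i < N" "i' < N" "1 \<le> j" "1 \<le> j'" "j \<le> M" "j' \<le> M"
        "j = M \<Longrightarrow> i < M" "j' = M \<Longrightarrow> i' < M"
        using P[OF p(1)] P[OF p(2)] by auto
      have "s i j = i + j \<or> s i j + N = i + j" "s i' j' = i' + j' \<or> s i' j' + N = i' + j'"
        unfolding s_def by simp_all
      \<comment> \<open>Two representations of one edge from different starts go once around the
        cycle. Both jumps are at most \<open>M\<close>, hence equal to \<open>M\<close>, and the
        restriction on the starts excludes this.\<close>
      then have "j + j' = N \<and> (i' = i + j \<or> i = i' + j')"
        using eqs b(1-6) hM(2) by linarith
      then have "j = M" "j' = M" "i' = i + M \<or> i = i' + M" using b(5,6) hM(2) by auto
      then show ?thesis using b(7,8) by linarith
    qed
  qed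
  then have "card E = card P" unfolding E_def by (rule card_image)
  also have "\<dots> = N * h + card Q"
    unfolding P_def using hM by (subst card_Un_disjoint) (auto simp: Q_def)
  also have "\<dots> = (d * N) div 2"
  proof (cases "odd d")
    case True
    then have "d = 2 * h + 1" by (simp add: h_def)
    then have "d * N = N + 2 * (N * h)" by (simp add: algebra_simps)
    then show ?thesis using True by (simp add: Q_def M_def)
  next
    case False
    then have "d = 2 * h" by (simp add: h_def)
    then show ?thesis using False by (simp add: Q_def)
  qed
  finally have "card E = (d * N) div 2" .
  moreover have "card (nbhd E v) \<le> d" for v
  proof -
    \<comment> \<open>Forward neighbours, backward neighbours written as forward jumps by
      \<open>N - j\<close>, and the possible partner in the matching.\<close>
    let ?A = "(\<lambda>j. s v j) ` {1..h}" and ?B = "(\<lambda>j. s v (N - j)) ` {1..h}"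
    let ?W = "if odd d then {if v < M then v + M else v - M} else {}"
    have "nbhd E v \<subseteq> ?A \<union> ?B \<union> ?W"
    proof
      fix u assume "u \<in> nbhd E v"
      then have "{v, u} \<in> (\<lambda>(i, j). {i, s i j}) ` P" by (simp add: nbhd_iff E_def)
      then obtain i j where ij: "(i, j) \<in> P" "{v, u} = {i, s i j}" by auto
      from ij(1) consider "(i, j) \<in> Q" | "i < N" "j \<in> {1..h}" by (auto simp: P_def)
      then show "u \<in> ?A \<union> ?B \<union> ?W"
      proof cases
        case 1
        then have "odd d" "i < M" "j = M" by (auto simp: Q_def split: if_splits)
        moreover from this have "s i j = i + M" using hM by (simp add: s_def)
        ultimately have "u = (if v < M then v + M else v - M)"
          using ij(2) by (auto simp: doubleton_eq_iff)
        then show ?thesis using \<open>odd d\<close> by simp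
      next
        case 2
        from ij(2) consider "v = i" "u = s i j" | "u = i" "v = s i j"
          by (auto simp: doubleton_eq_iff)
        then show ?thesis
        proof cases
          case 1
          then have "u \<in> ?A" using 2(2) by blast
          then show ?thesis by blast
        next
          case u: 2
          have "u = s v (N - j)" using u 2 hM by (simp add: s_def split: if_splits)
          then have "u \<in> ?B" using 2(2) by blast
          then show ?thesis by blast
        qed
      qed
    qed
    then have "card (nbhd E v) \<le> card (?A \<union> ?B \<union> ?W)"
      by (rule card_mono[rotated]) simp
    also have "\<dots> \<le> card ?A + card ?B + card ?W"
      by (meson add_le_mono1 card_Un_le le_trans)
    also have "\<dots> \<le> h + h + card ?W"
      using card_image_le[of "{1..h}" "\<lambda>j. s v j"] card_image_le[of "{1..h}" "\<lambda>j. s v (N - j)"]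
      by (intro add_mono) simp_all
    also have "\<dots> \<le> d" by (auto simp: h_def elim!: oddE)
    finally show ?thesis .
  qed
  ultimately show ?thesis using sg by blast
qed

section \<open>The extremal number\<close>

text \<open>The set under \<open>Max\<close> is finite and contains the size of the edgeless graph,
  so the maximum is attained.\<close>

lemma ex_T1_extremal:
  assumes "n \<ge> 5"
  shows "2 * ex p (T1_vertices n) (T1_edges n) + deficit (n - 1) p \<le> (n - 2) * p"
    and "\<And>E. simple_graph {0..<p} E \<Longrightarrow> T1_free n {0..<p} E \<Longrightarrow>
      card E \<le> ex p (T1_vertices n) (T1_edges n)"
proof -
  let ?A = "{card E | E. simple_graph {0..<p} E \<and> T1_free n {0..<p} E}"
  have "?A \<subseteq> card ` Pow (clique {0..<p})"
    using simple_graph_edges_subset by blast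
  then have fin: "finite ?A" by (rule finite_subset) (simp add: card_clique(1))
  have "T1_free n {0..<p} {}" by (auto simp: contains_graph_def T1_edges_def)
  moreover have "simple_graph {0..<p} {}" by (simp add: simple_graph_def)
  ultimately have "card ({} :: nat set set) \<in> ?A" by blast
  then have "Max ?A \<in> ?A" using fin by (intro Max_in) auto
  then obtain E where "simple_graph {0..<p} E" "T1_free n {0..<p} E" "Max ?A = card E" by auto
  then show "2 * ex p (T1_vertices n) (T1_edges n) + deficit (n - 1) p \<le> (n - 2) * p"
    using T1_free_edge_bound[of "{0..<p}" E n] assms by (simp add: ex_def)
  show "card E \<le> ex p (T1_vertices n) (T1_edges n)"
    if "simple_graph {0..<p} E" "T1_free n {0..<p} E" for E
    using that fin unfolding ex_def by (intro Max_ge) auto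
qed

text \<open>The lower bounds come from \<open>k\<close> complete graphs on \<open>n - 1\<close>
  vertices with one on \<open>r\<close> vertices, and from \<open>k - 1\<close> of them with a
  near-regular graph on \<open>n - 1 + r\<close> vertices.\<close>

lemma ex_T1_bounds:
  fixes p n k r :: nat
  assumes n: "n \<ge> 5" and k: "k \<ge> 1" and r: "r \<le> n - 2" and p: "p = k * (n - 1) + r"
  defines "X \<equiv> ex p (T1_vertices n) (T1_edges n)"
  shows "2 * X + min (r * (n - 1 - r)) (2 * (n - 1 + r)) \<le> (n - 2) * p"
    and "(n - 2) * p \<le> 2 * X + r * (n - 1 - r)"
    and "((n - 2) * p) div 2 \<le> X + (n - 1 + r)"
proof -
  obtain m where m: "n = m + 5" using n by (metis add.commute le_Suc_ex)
  obtain l where l: "k = Suc l" using k by (cases k) auto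
  have "p mod (n - 1) = r" using p r n by simp
  moreover have "n - 1 \<le> p" using p l by simp
  ultimately show "2 * X + min (r * (n - 1 - r)) (2 * (n - 1 + r)) \<le> (n - 2) * p"
    using ex_T1_extremal(1)[OF n, of p] by (simp add: X_def deficit_def Let_def)
  have "simple_graph {0..<r} (clique {0..<r})" "T1_free n {0..<r} (clique {0..<r})"
    using r n by (simp_all add: simple_graph_clique T1_free_card)
  from add_cliques[OF this(1) n this(2), of k] obtain E where
    E: "simple_graph {0..<p} E" "T1_free n {0..<p} E"
      "2 * card E = 2 * card (clique {0..<r}) + k * ((n - 1) * (n - 2))"
    using p by (auto simp: add.commute)
  have "2 * card (clique {0..<r}) = r * (r - 1)"
    using card_clique(2)[of "{0..<r}"] by simp
  then have "r * (r - 1) + k * ((n - 1) * (n - 2)) \<le> 2 * X"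
    using E ex_T1_extremal(2)[OF n E(1,2)] by (simp add: X_def)
  moreover have "(n - 2) * p = r * (r - 1) + k * ((n - 1) * (n - 2)) + r * (n - 1 - r)"
  proof -
    obtain t where t: "n - 2 = r + t" using r le_Suc_ex by blast
    then have t': "n - 1 = r + t + 1" "n - 1 - r = t + 1" using n by linarith+
    have "(r + t) * (k * (r + t + 1) + r) = r * (r - 1) + k * ((r + t + 1) * (r + t)) + r * (t + 1)"
      by (cases r) (simp_all add: algebra_simps)
    then show ?thesis unfolding p t t'(2) unfolding t'(1) .
  qed
  ultimately show "(n - 2) * p \<le> 2 * X + r * (n - 1 - r)" by linarith
  obtain E0 where E0: "simple_graph {0..<n - 1 + r} E0" "\<forall>v. card (nbhd E0 v) \<le> n - 4"
    "card E0 = ((n - 4) * (n - 1 + r)) div 2"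
    using near_regular_graph[of "n - 4" "n - 1 + r"] m by auto
  have "T1_free n {0..<n - 1 + r} E0" using E0 n by (intro T1_free_max_degree) auto
  have "n - 1 + r + l * (n - 1) = p" using p l by simp
  with add_cliques[OF E0(1) n \<open>T1_free n {0..<n - 1 + r} E0\<close>, of l] obtain E' where
    E': "simple_graph {0..<p} E'" "T1_free n {0..<p} E'"
      "2 * card E' = 2 * card E0 + l * ((n - 1) * (n - 2))"
    by auto
  have "(m + 3) * (Suc l * (m + 4) + r) =
      l * ((m + 4) * (m + 3)) + 2 * (m + 4 + r) + (m + 1) * (m + 4 + r)"
    by (simp add: algebra_simps)
  moreover have "n - 1 = m + 4" "n - 2 = m + 3" "n - 4 = m + 1" using m by simp_all
  ultimately have "(n - 2) * p = l * ((n - 1) * (n - 2)) + 2 * (n - 1 + r) + (n - 4) * (n - 1 + r)"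
    by (simp only: p l)
  moreover have "card E0 \<le> card E'" using E'(3) by linarith
  then obtain z where z: "card E' = card E0 + z" using le_Suc_ex by blast
  \<comment> \<open>The complete graphs contribute an even amount, so halving rounds only the
    near-regular part, just as in the size of \<open>E0\<close>.\<close>
  then have "l * ((n - 1) * (n - 2)) = 2 * z" using E'(3) by linarith
  ultimately have "(n - 2) * p = 2 * (z + (n - 1 + r)) + (n - 4) * (n - 1 + r)"
    by (simp only: add_mult_distrib2 add.assoc)
  moreover have "(2 * a + b) div 2 = a + b div 2" for a b :: nat by simp
  ultimately have "(n - 2) * p div 2 = z + (n - 1 + r) + card E0" by (simp only: E0(3))
  then have "(n - 2) * p div 2 = card E' + (n - 1 + r)" using z by linarith
  then show "((n - 2) * p) div 2 \<le> X + (n - 1 + r)"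
    using ex_T1_extremal(2)[OF n E'(1,2)] by (simp add: X_def)
qed

section \<open>Comparison of the two candidate values\<close>

text \<open>With \<open>u = n - 2 - r\<close> the integer \<open>(r - 2) * (u - 3)\<close> is
  compared with 8; the listed ranges are the points with \<open>r \<ge> 3\<close> and
  \<open>u \<ge> 4\<close> at which the product is at least 8.\<close>

lemma sparse_regime:
  fixes n r :: nat
  assumes "n \<ge> 5" "r \<le> n - 2"
  defines "c \<equiv> (n \<ge> 16 \<and> 3 \<le> r \<and> r \<le> n - 6) \<or> (13 \<le> n \<and> n \<le> 15 \<and> 4 \<le> r \<and> r \<le> n - 7)"
  shows "c \<Longrightarrow> 2 * (n - 1 + r) \<le> r * (n - 1 - r)"
    and "\<not> c \<Longrightarrow> r * (n - 1 - r) \<le> 2 * (n - 1 + r)"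
proof -
  have "r + 2 \<le> n" using assms(1,2) by linarith
  then obtain u where "n = r + 2 + u" using le_Suc_ex by blast
  then have u: "n = r + u + 2" by simp
  have R: "r * (n - 1 - r) = r * u + r" and Q: "2 * (n - 1 + r) = 4 * r + 2 * u + 2"
    by (simp_all add: u)
  show "2 * (n - 1 + r) \<le> r * (n - 1 - r)" if c
  proof -
    have "3 \<le> r \<and> 4 \<le> u \<and> 14 \<le> r + u \<or> 4 \<le> r \<and> 5 \<le> u \<and> 11 \<le> r + u"
      using that unfolding c_def u by (elim disjE conjE; linarith)
    then have "3 * r + 2 * u + 2 \<le> r * u"
    proof (elim disjE conjE)
      assume "3 \<le> r" "4 \<le> u" and sum: "14 \<le> r + u"
      then obtain a b where ab: "r = 3 + a" "u = 4 + b" by (metis le_Suc_ex)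
      then show ?thesis using sum by (simp add: algebra_simps)
    next
      assume "4 \<le> r" "5 \<le> u" and sum: "11 \<le> r + u"
      then obtain a b where ab: "r = 4 + a" "u = 5 + b" by (metis le_Suc_ex)
      then show ?thesis using sum by (simp add: algebra_simps)
    qed
    then show ?thesis unfolding R Q by linarith
  qed
  show "r * (n - 1 - r) \<le> 2 * (n - 1 + r)" if nc: "\<not> c"
  proof -
    have "r \<le> 2 \<or> u \<le> 3 \<or> r = 3 \<and> u \<le> 10 \<or> u = 4 \<and> r \<le> 9 \<or> 4 \<le> r \<and> 5 \<le> u \<and> r + u \<le> 10"
    proof (rule ccontr)
      assume no: "\<not> ?thesis"
      then have "3 \<le> r" "4 \<le> u" by simp_all
      then have "r \<le> n - 6" using u by linarith
      then have "r + u \<le> 13" using nc \<open>3 \<le> r\<close> u unfolding c_def by linarith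
      moreover have "4 \<le> r" "5 \<le> u" using no \<open>3 \<le> r\<close> \<open>4 \<le> u\<close> calculation by linarith+
      moreover have "11 \<le> r + u" using no calculation by linarith
      ultimately have c using u unfolding c_def by simp
      then show False using nc by blast
    qed
    then have "r * u \<le> 3 * r + 2 * u + 2"
    proof (elim disjE conjE)
      assume "r \<le> 2"
      then have "r * u \<le> 2 * u" by simp
      then show ?thesis by linarith
    next
      assume "u \<le> 3"
      then have "r * u \<le> r * 3" by (intro mult_left_mono) simp_all
      then show ?thesis by linarith
    next
      assume "4 \<le> r" "5 \<le> u" "r + u \<le> 10"
      then have "r \<in> {4, 5} \<and> (u = 5 \<or> u = 6 \<and> r = 4)" by auto
      then show ?thesis by auto
    qed simp_all
    then show ?thesis unfolding R Q by linarith
  qed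
qed

theorem theorem2p1:
  fixes p n k r :: nat
  assumes "p \<ge> n - 1" and "n - 1 \<ge> 4"
    and "k \<ge> 1" and "r \<le> n - 2" and "p = k * (n - 1) + r"
  shows "real (ex p (T1_vertices n) (T1_edges n)) =
           max (real_of_int (floor ((real n - 2) * real p / 2)) - (real n - 1 + real r))
               (((real n - 2) * real p - real r * (real n - 1 - real r)) / 2)
       \<and> real (ex p (T1_vertices n) (T1_edges n)) =
           (if (n \<ge> 16 \<and> 3 \<le> r \<and> r \<le> n - 6) \<or> (13 \<le> n \<and> n \<le> 15 \<and> 4 \<le> r \<and> r \<le> n - 7)
            then real_of_int (floor ((real n - 2) * real p / 2)) - (real n - 1 + real r)
            else ((real n - 2) * real p - real r * (real n - 1 - real r)) / 2)"
proof -
  define X where "X = ex p (T1_vertices n) (T1_edges n)"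
  define A R Q where "A = (n - 2) * p" and "R = r * (n - 1 - r)" and "Q = n - 1 + r"
  have n: "n \<ge> 5" using assms(2) by simp
  have b: "2 * X + min R (2 * Q) \<le> A" "A \<le> 2 * X + R" "A div 2 \<le> X + Q"
    using ex_T1_bounds[OF n assms(3-5)] by (simp_all add: X_def A_def R_def Q_def)
  have "(real n - 2) * real p = real A" using n by (simp add: A_def of_nat_diff)
  moreover have "\<lfloor>real A / 2\<rfloor> = int (A div 2)"
    using floor_divide_of_nat_eq[of A 2, where ?'a = real] by simp
  ultimately have F: "real_of_int (floor ((real n - 2) * real p / 2)) - (real n - 1 + real r)
      = real (A div 2) - real Q" using n by (simp add: Q_def of_nat_diff)
  have "real r * (real n - 1 - real r) = real R"
    using n assms(4) by (simp add: R_def of_nat_diff)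
  then have S: "((real n - 2) * real p - real r * (real n - 1 - real r)) / 2 = (real A - real R) / 2"
    using \<open>(real n - 2) * real p = real A\<close> by simp
  \<comment> \<open>Here the upper and lower bounds on \<open>2 * X\<close> coincide, so no rounding
    enters.\<close>
  have clique: "real X = (real A - real R) / 2" if "R \<le> 2 * Q"
  proof -
    have "A = 2 * X + R" using b(1,2) that by simp
    then show ?thesis by simp
  qed
  \<comment> \<open>Here \<open>A\<close> may be odd: the integer \<open>X + Q\<close> is at most
    half of \<open>A\<close> and at least the floor of that half, hence equal to the floor.\<close>
  have sparse: "real X = real (A div 2) - real Q" if "2 * Q \<le> R"
  proof -
    have "2 * (X + Q) \<le> A" using b(1) that by simp
    then have "A div 2 = X + Q" using b(3) by presburger
    then show ?thesis by simp
  qed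
  have "real A \<le> real (2 * X + R)" "real (A div 2) \<le> real (X + Q)"
    using b(2,3) by (simp_all only: of_nat_le_iff)
  then have "(real A - real R) / 2 \<le> real X" "real (A div 2) - real Q \<le> real X"
    by simp_all
  then have "real X = max (real (A div 2) - real Q) ((real A - real R) / 2)"
    using clique sparse by (cases "R \<le> 2 * Q") simp_all
  moreover have "real X = (if (n \<ge> 16 \<and> 3 \<le> r \<and> r \<le> n - 6) \<or> (13 \<le> n \<and> n \<le> 15 \<and> 4 \<le> r \<and> r \<le> n - 7)
      then real (A div 2) - real Q else (real A - real R) / 2)" (is "_ = (if ?c then _ else _)")
  proof (cases ?c)
    case True
    then show ?thesis
      using sparse[unfolded R_def Q_def] sparse_regime(1)[OF n assms(4)]
      unfolding if_P[OF True] R_def Q_def by blast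
  next
    case False
    then show ?thesis
      using clique[unfolded R_def Q_def] sparse_regime(2)[OF n assms(4)]
      unfolding if_not_P[OF False] R_def Q_def by blast
  qed
  ultimately show ?thesis
    unfolding F S X_def[symmetric] by (rule conjI)
qed

end
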